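(* Let $f:[0,\infty)\to[0,\infty)$, $K>0$, $M\ge1$ and $c$ satisfy Assumptions A and B (stated in the context), and let $\mu_1,\mu_2$ be the numbers defined in the context. Suppose there exists $\delta\in\left(0,\frac12\right)$ such that $\alpha_n\in(\delta,1-\delta)$ for every $n\in\mathbb{N}_0$. Then, for each $x_0>0$, there exists $n_0\in\mathbb{N}_0$ such that the solution $\{x_n\}$ of $$x_{n+1}=\alpha_n x_n+(1-\alpha_n)f(x_n),\qquad n\in\mathbb{N}_0,$$ with initial value $x_0$ satisfies $x_n\in[\mu_1,\mu_2]$ for all $n\ge n_0$.
   Context: $\mathbb{N}_0=\{0,1,2,\dots\}$. Assumption A: $f:[0,\infty)\to[0,\infty)$ is a continuous function, $f(x)>0$ for $x>0$, $f(x)>x$ for $x\in(0,K)$, $f(x)<x$ for $x>K$, and $M\ge1$ is a constant such that $|f(x)-K|\le M|x-K|$ for all $x\ge 0$. (Hence $K>0$ is the unique positive fixed point of $f$.) Assumption B: there is a point $c\in[0,K)$ such that $f$ is strictly decreasing on $[c,\infty)$. (Consequently the maximum of $f$ on $[0,\infty)$ is attained on $[0,c]$.) Definition of $\mu_0,\mu_1,\mu_2$: $\mu_0:=\inf\{x\in[0,c]: f(x)=\max_{s\in[0,\infty)}f(s)\}$ is the smallest point where the maximum of $f$ is attained; $\mu_2:=f(\mu_0)$ is the value of this maximum; $\mu_1:=f(\mu_2)$. One has $\mu_1<K<\mu_2$. *)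

theory Defs
  imports "HOL-Analysis.Analysis"
begin

text \<open>Functions \<open>f : [0,\<infinity>) \<rightarrow> [0,\<infinity>)\<close> are represented by total functions on the
  reals; values at negative arguments play no role.\<close>

definition assumption_A :: "(real \<Rightarrow> real) \<Rightarrow> real \<Rightarrow> real \<Rightarrow> bool" where
  "assumption_A f K M \<longleftrightarrow>
     f \<in> {0..} \<rightarrow> {0..} \<and> continuous_on {0..} f \<and>
     (\<forall>x>0. f x > 0) \<and>
     (\<forall>x\<in>{0<..<K}. f x > x) \<and>
     (\<forall>x>K. f x < x) \<and>
     M \<ge> 1 \<and> (\<forall>x\<ge>0. \<bar>f x - K\<bar> \<le> M * \<bar>x - K\<bar>)"

definition assumption_B :: "(real \<Rightarrow> real) \<Rightarrow> real \<Rightarrow> real \<Rightarrow> bool" where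
  "assumption_B f K c \<longleftrightarrow> c \<in> {0..<K} \<and> strict_antimono_on {c..} f"

text \<open>The condition \<open>\<forall>s\<ge>0. f s \<le> f x\<close> says that \<open>f x\<close> is the maximum of \<open>f\<close> on
  \<open>[0,\<infinity>)\<close>. Under the two assumptions above, the set of such points in \<open>[0,c]\<close> is
  nonempty, so the infimum is meaningful.\<close>

definition mu0 :: "(real \<Rightarrow> real) \<Rightarrow> real \<Rightarrow> real" where
  "mu0 f c = Inf {x \<in> {0..c}. \<forall>s\<ge>0. f s \<le> f x}"

definition mu2 :: "(real \<Rightarrow> real) \<Rightarrow> real \<Rightarrow> real" where
  "mu2 f c = f (mu0 f c)"

definition mu1 :: "(real \<Rightarrow> real) \<Rightarrow> real \<Rightarrow> real" where
  "mu1 f c = f (mu2 f c)"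

primrec solution :: "(real \<Rightarrow> real) \<Rightarrow> (nat \<Rightarrow> real) \<Rightarrow> real \<Rightarrow> nat \<Rightarrow> real" where
  "solution f \<alpha> x0 0 = x0"
| "solution f \<alpha> x0 (Suc n) =
     \<alpha> n * solution f \<alpha> x0 n + (1 - \<alpha> n) * f (solution f \<alpha> x0 n)"

end

theory Submission
  imports Defs
begin

text \<open>Write \<open>B\<close> for \<open>mu2 f c\<close>, the maximum of \<open>f\<close>, and \<open>A\<close> for \<open>mu1 f c = f B\<close>; then
  \<open>A < K < B\<close>. Every interval \<open>[p, B]\<close> with \<open>0 < p \<le> A\<close> is mapped into itself by \<open>f\<close>: to the left of
  \<open>K\<close> the function lies above the diagonal, and on \<open>[K, B]\<close> it is decreasing, hence at least
  \<open>f B = A\<close> (\<open>f_maps_interval\<close>). Since \<open>x\<^sub>n\<^sub>+\<^sub>1\<close> is a convex combination of \<open>x\<^sub>n\<close> and \<open>f x\<^sub>n\<close>, a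
  solution never leaves such an interval (\<open>solution_stays\<close>), and it remains to show that \<open>[A, B]\<close>
  is reached.

  This happens in two stages, each by a uniform step size. Above \<open>B\<close> the value of \<open>f\<close> is at most
  \<open>A\<close>, so \<open>x\<^sub>n\<close> falls by at least \<open>\<delta> (B - A)\<close> per step and gets below \<open>B\<close> at some time \<open>N\<close>. If then
  \<open>x\<^sub>N < A\<close>, the solution is confined to \<open>[x\<^sub>N, B]\<close>, and \<open>f x - x\<close> has a positive minimum \<open>\<epsilon>\<close> on the
  compact interval \<open>[x\<^sub>N, A]\<close> because \<open>0 < x\<^sub>N\<close> and \<open>A < K\<close>; so as long as \<open>x\<^sub>n < A\<close> it grows by at
  least \<open>\<delta> \<epsilon>\<close> per step. A jump over \<open>[A, B]\<close> in this second stage is impossible, since the solution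
  can no longer exceed \<open>B\<close>.\<close>

lemma decreasing_steps_reach:
  fixes x :: "nat \<Rightarrow> real"
  assumes "\<eta> > 0" and step: "\<And>n. x n > b \<Longrightarrow> x (Suc n) \<le> x n - \<eta>"
  shows "\<exists>n. x n \<le> b"
proof (rule ccontr)
  assume "\<not> ?thesis"
  then have above: "x n > b" for n by (simp add: not_le)
  have "x n \<le> x 0 - of_nat n * \<eta>" for n
  proof (induction n)
    case (Suc n)
    with step[OF above, of n] show ?case by (simp add: algebra_simps)
  qed simp
  moreover obtain n where "x 0 - b < of_nat n * \<eta>"
    using reals_Archimedean3[OF \<open>\<eta> > 0\<close>] by blast
  ultimately show False using above[of n] by (smt (verit))
qed

lemma solution_stays:
  assumes "\<And>n. \<alpha> n \<in> {0..1}" and "f \<in> S \<rightarrow> S" and "convex S"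
    and "solution f \<alpha> x0 N \<in> S" and "N \<le> n"
  shows "solution f \<alpha> x0 n \<in> S"
  using \<open>N \<le> n\<close>
proof (induction rule: dec_induct)
  case (step n)
  with assms(2) have "f (solution f \<alpha> x0 n) \<in> S" by blast
  with step.IH show ?case
    using convexD[OF \<open>convex S\<close>, of "solution f \<alpha> x0 n" "f (solution f \<alpha> x0 n)" "\<alpha> n" "1 - \<alpha> n"]
      assms(1)[of n] by simp
qed (fact assms(4))

lemma fixed_point:
  assumes "K > 0" "assumption_A f K M"
  shows "f K = K"
proof -
  have "\<bar>f K - K\<bar> \<le> M * \<bar>K - K\<bar>"
    using assms unfolding assumption_A_def by (metis less_imp_le)
  then show ?thesis by simp
qed

lemma decreasing_beyond_K:
  assumes "assumption_B f K c" "K \<le> x" "x < y"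
  shows "f y < f x"
  using assms monotone_onD[of "{c..}" "(<)" "(>)" f x y]
  unfolding assumption_B_def by simp

text \<open>The infimum defining \<open>mu0\<close> is taken over a closed set, the preimage of the maximum, and so is
  itself a maximum point. The set is nonempty because a maximum over \<open>[0, c]\<close> is global: beyond
  \<open>c\<close> the function decreases.\<close>

lemma f_le_mu2:
  assumes A: "assumption_A f K M" and B: "assumption_B f K c" and "x \<ge> 0"
  shows "f x \<le> mu2 f c"
proof -
  let ?S = "{x \<in> {0..c}. \<forall>s\<ge>0. f s \<le> f x}"
  have dec: "f y \<le> f c" if "c \<le> y" for y
    using B that monotone_onD[of "{c..}" "(<)" "(>)" f c y] unfolding assumption_B_def
    by (cases "c = y") simp_all
  have "0 \<le> c" using B by (simp add: assumption_B_def)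
  have cont: "continuous_on {0..c} f"
    using A unfolding assumption_A_def by (auto intro: continuous_on_subset)
  obtain m where m: "m \<in> {0..c}" "\<And>y. y \<in> {0..c} \<Longrightarrow> f y \<le> f m"
    using continuous_attains_sup[OF compact_Icc _ cont] \<open>0 \<le> c\<close> by auto
  have max: "f s \<le> f m" if "s \<ge> 0" for s
  proof (cases "s \<le> c")
    case False
    then have "f s \<le> f c" using dec by simp
    also have "\<dots> \<le> f m" using m(2)[of c] \<open>0 \<le> c\<close> by simp
    finally show ?thesis .
  qed (use m(2) that in simp)
  have "(\<forall>s\<ge>0. f s \<le> f x) \<longleftrightarrow> f x = f m" if "x \<in> {0..c}" for x
    using m(1) max that by (metis atLeastAtMost_iff antisym)
  then have "?S = {x \<in> {0..c}. f x = f m}" by blast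
  then have "closed ?S"
    using continuous_closed_preimage_constant[OF cont closed_atLeastAtMost] by simp
  moreover have "?S \<noteq> {}" using m(1) max by blast
  moreover have "bdd_below ?S" by (rule bdd_belowI[of _ 0]) simp
  ultimately have "Inf ?S \<in> ?S" by (intro closed_contains_Inf)
  with \<open>x \<ge> 0\<close> show ?thesis by (simp add: mu2_def mu0_def)
qed

lemma K_less_mu2:
  assumes "K > 0" and A: "assumption_A f K M" and B: "assumption_B f K c"
  shows "K < mu2 f c"
proof -
  have "0 \<le> c" "c < K" "strict_antimono_on {c..} f"
    using B by (auto simp: assumption_B_def)
  then have "f K < f c" using monotone_onD[of "{c..}" "(<)" "(>)" f c K] by simp
  with f_le_mu2[OF A B \<open>0 \<le> c\<close>] fixed_point[OF \<open>K > 0\<close> A] show ?thesis by simp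
qed

lemma mu1_less_K:
  assumes "K > 0" and A: "assumption_A f K M" and B: "assumption_B f K c"
  shows "mu1 f c < K"
  using decreasing_beyond_K[OF B order_refl K_less_mu2[OF assms]] fixed_point[OF \<open>K > 0\<close> A]
  by (simp add: mu1_def)

text \<open>The left endpoint is left free because the interval is needed both with \<open>p = mu1 f c\<close>, the
  final trapping region, and with the value of a solution that still lies below \<open>mu1 f c\<close>.\<close>

lemma f_maps_interval:
  assumes "K > 0" and A: "assumption_A f K M" and B: "assumption_B f K c"
    and "0 < p" "p \<le> mu1 f c"
  shows "f \<in> {p..mu2 f c} \<rightarrow> {p..mu2 f c}"
proof
  fix x assume x: "x \<in> {p..mu2 f c}"
  have "p \<le> f x"
  proof (cases "x < K")
    case True
    then have "x < f x" using A x \<open>0 < p\<close> by (auto simp: assumption_A_def)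
    with x show ?thesis by simp
  next
    case False
    then have "mu1 f c \<le> f x"
      using decreasing_beyond_K[OF B, of x "mu2 f c"] x
      by (cases "x = mu2 f c") (auto simp: mu1_def)
    with \<open>p \<le> mu1 f c\<close> show ?thesis by simp
  qed
  with f_le_mu2[OF A B, of x] x \<open>0 < p\<close> show "f x \<in> {p..mu2 f c}" by simp
qed

text \<open>Above \<open>mu2 f c\<close> the gap \<open>x - f x\<close> exceeds \<open>mu2 f c - mu1 f c\<close>, because \<open>f\<close> is decreasing
  there, and the weight \<open>1 - \<alpha> n > \<delta>\<close> makes each step descend by more than the fraction \<open>\<delta>\<close> of it.\<close>

lemma solution_falls_below_mu2:
  assumes "K > 0" and A: "assumption_A f K M" and B: "assumption_B f K c"
    and "\<delta> > 0" and \<alpha>: "\<And>n. \<alpha> n < 1 - \<delta>"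
  shows "\<exists>n. solution f \<alpha> x0 n \<le> mu2 f c"
proof (rule decreasing_steps_reach)
  have less: "mu1 f c < K" "K < mu2 f c"
    using mu1_less_K K_less_mu2 assms by blast+
  then show "0 < \<delta> * (mu2 f c - mu1 f c)" using \<open>\<delta> > 0\<close> by simp
  fix n
  let ?x = "solution f \<alpha> x0 n"
  assume x: "mu2 f c < ?x"
  then have "f ?x < mu1 f c"
    using decreasing_beyond_K[OF B _ x] less by (simp add: mu1_def)
  then have "\<delta> * (mu2 f c - mu1 f c) \<le> (1 - \<alpha> n) * (?x - f ?x)"
    using x less \<open>\<delta> > 0\<close> \<alpha>[of n] by (intro mult_mono) auto
  then show "solution f \<alpha> x0 (Suc n) \<le> ?x - \<delta> * (mu2 f c - mu1 f c)"
    by (simp add: algebra_simps)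
qed

text \<open>Near \<open>0\<close> the gap \<open>f x - x\<close> may be arbitrarily small, so a uniform step size requires that
  the solution stay away from \<open>0\<close>; confinement to \<open>[x\<^sub>N, mu2 f c]\<close> ensures this.\<close>

lemma solution_rises_above_mu1:
  assumes "K > 0" and A: "assumption_A f K M" and B: "assumption_B f K c"
    and "\<delta> > 0" and \<alpha>: "\<And>n. \<alpha> n \<in> {0..<1 - \<delta>}"
    and N: "0 < solution f \<alpha> x0 N" "solution f \<alpha> x0 N < mu1 f c"
  shows "\<exists>n\<ge>N. mu1 f c \<le> solution f \<alpha> x0 n"
proof -
  let ?x = "solution f \<alpha> x0"
  have less: "mu1 f c < K" "K < mu2 f c"
    using mu1_less_K K_less_mu2 assms by blast+
  have "continuous_on {?x N..mu1 f c} f"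
    using A N(1) unfolding assumption_A_def by (auto intro: continuous_on_subset)
  then have "continuous_on {?x N..mu1 f c} (\<lambda>y. f y - y)"
    by (intro continuous_intros)
  then obtain m where m: "m \<in> {?x N..mu1 f c}"
      "\<And>y. y \<in> {?x N..mu1 f c} \<Longrightarrow> f m - m \<le> f y - y"
    using continuous_attains_inf[OF compact_Icc, of "?x N" "mu1 f c" "\<lambda>y. f y - y"] N(2)
    by (auto simp del: solution.simps)
  have gap: "f m - m > 0"
    using A m(1) N(1) less by (auto simp: assumption_A_def)
  have ge: "?x N \<le> ?x n" if "N \<le> n" for n
  proof -
    have "?x n \<in> {?x N..mu2 f c}"
    proof (rule solution_stays)
      show "\<alpha> n \<in> {0..1}" for n using \<alpha>[of n] \<open>\<delta> > 0\<close> by simp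
      show "f \<in> {?x N..mu2 f c} \<rightarrow> {?x N..mu2 f c}"
        using f_maps_interval[OF \<open>K > 0\<close> A B N(1)] N(2) by simp
      show "?x N \<in> {?x N..mu2 f c}" using N(2) less by simp
    qed (use that in simp_all)
    then show ?thesis by simp
  qed
  \<comment> \<open>Negation turns growth towards \<open>mu1\<close> into descent.\<close>
  have "\<exists>k. - ?x (N + k) \<le> - mu1 f c"
  proof (rule decreasing_steps_reach)
    show "0 < \<delta> * (f m - m)" using gap \<open>\<delta> > 0\<close> by simp
    fix k assume below: "- mu1 f c < - ?x (N + k)"
    let ?y = "?x (N + k)"
    have "\<delta> * (f m - m) \<le> (1 - \<alpha> (N + k)) * (f ?y - ?y)"
      using m(2)[of ?y] below ge[of "N + k"] gap \<open>\<delta> > 0\<close> \<alpha>[of "N + k"]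
      by (intro mult_mono) auto
    then show "- ?x (N + Suc k) \<le> - ?y - \<delta> * (f m - m)"
      by (simp add: algebra_simps)
  qed
  then show ?thesis by (meson le_add1 neg_le_iff_le)
qed

theorem lemma2p6:
  fixes f :: "real \<Rightarrow> real" and K M c :: real and \<alpha> :: "nat \<Rightarrow> real"
  assumes "K > 0"
    and "assumption_A f K M"
    and "assumption_B f K c"
    and "\<exists>\<delta>\<in>{0<..<1/2}. \<forall>n. \<alpha> n \<in> {\<delta><..<1 - \<delta>}"
  shows "\<forall>x0>0. \<exists>n0. \<forall>n\<ge>n0. solution f \<alpha> x0 n \<in> {mu1 f c..mu2 f c}"
proof (intro allI impI)
  fix x0 :: real assume "x0 > 0"
  let ?x = "solution f \<alpha> x0"
  note A = assms(2) and B = assms(3)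
  obtain \<delta> where \<delta>: "\<delta> > 0" and bounds: "\<And>n. \<alpha> n \<in> {\<delta><..<1 - \<delta>}"
    using assms(4) by auto
  have \<alpha>: "\<alpha> n \<in> {0..<1 - \<delta>}" "\<alpha> n < 1 - \<delta>" "\<alpha> n \<in> {0..1}" for n
    using bounds[of n] \<delta> by auto
  have fpos: "f y > 0" if "y > 0" for y
    using A that by (simp add: assumption_A_def)
  have pos: "?x n > 0" for n
    using solution_stays[of \<alpha> f "{0<..}" x0 0 n] \<alpha>(3) fpos \<open>x0 > 0\<close> by auto
  have mu1_pos: "mu1 f c > 0"
    using fpos K_less_mu2[OF \<open>K > 0\<close> A B] \<open>K > 0\<close> by (simp add: mu1_def)
  obtain N where N: "?x N \<le> mu2 f c"
    using solution_falls_below_mu2[where \<alpha> = \<alpha>, OF \<open>K > 0\<close> A B \<delta> \<alpha>(2)] by blast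
  have "\<exists>n0. ?x n0 \<in> {mu1 f c..mu2 f c}"
  proof (cases "?x N < mu1 f c")
    case True
    obtain n where n: "n \<ge> N" "mu1 f c \<le> ?x n"
      using solution_rises_above_mu1[where \<alpha> = \<alpha>, OF \<open>K > 0\<close> A B \<delta> \<alpha>(1) pos True] by blast
    have "f \<in> {?x N..mu2 f c} \<rightarrow> {?x N..mu2 f c}"
      using f_maps_interval[OF \<open>K > 0\<close> A B pos] True by simp
    then have "?x n \<in> {?x N..mu2 f c}"
      by (rule solution_stays[where \<alpha> = \<alpha> and N = N, OF \<alpha>(3) _ convex_real_interval(5) _ n(1)])
        (simp add: N)
    with n(2) show ?thesis by auto
  next
    case False
    with N show ?thesis by (intro exI[of _ N]) simp
  qed
  then obtain n0 where n0: "?x n0 \<in> {mu1 f c..mu2 f c}" by blast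
  have "f \<in> {mu1 f c..mu2 f c} \<rightarrow> {mu1 f c..mu2 f c}"
    by (rule f_maps_interval[OF \<open>K > 0\<close> A B mu1_pos order_refl])
  then show "\<exists>n0. \<forall>n\<ge>n0. ?x n \<in> {mu1 f c..mu2 f c}"
    using solution_stays[where \<alpha> = \<alpha>, OF \<alpha>(3) _ convex_real_interval(5) n0] by blast
qed

end
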